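(* Let $n\ge 2$ be an integer, let $\mathcal{A}$ be a unital Banach algebra, let $\mathcal{B}$ be a Banach algebra, and let $\varphi:\mathcal{A}\to\mathcal{B}$ be an $n$-Jordan homomorphism such that $\mathcal{B}$ is $\varphi$-commutative. Suppose that for every $x\in\mathcal{A}$, $\varphi(x^2)=0$ implies $\varphi(x)=0$. Then $\varphi$ is an $n$-homomorphism.
   Context: Banach algebras are complex and associative, and not assumed commutative. An $n$-Jordan homomorphism is a linear map $\varphi:\mathcal{A}\to\mathcal{B}$ with $\varphi(a^n)=\varphi(a)^n$ for all $a\in\mathcal{A}$. An $n$-homomorphism is a linear map $\varphi$ with $\varphi(a_1a_2\cdots a_n)=\varphi(a_1)\varphi(a_2)\cdots\varphi(a_n)$ for all $a_1,\dots,a_n\in\mathcal{A}$. $\mathcal{B}$ is called $\varphi$-commutative if $\varphi(a)\varphi(b)=\varphi(b)\varphi(a)$ for all $a,b\in\mathcal{A}$. *)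

theory Defs
  imports "HOL-Analysis.Analysis"
begin

text \<open>Complex Banach algebras, not assumed commutative or unital. The superclasses
  provide the ring structure, the complete submultiplicative norm and the underlying real scalar
  multiplication, which is required to be the restriction of the complex one.\<close>

class complex_banach_algebra = real_normed_algebra + banach +
  fixes scaleC :: "complex \<Rightarrow> 'a \<Rightarrow> 'a"
  assumes scaleC_add_right: "scaleC c (x + y) = scaleC c x + scaleC c y"
    and scaleC_add_left: "scaleC (c + d) x = scaleC c x + scaleC d x"
    and scaleC_scaleC: "scaleC c (scaleC d x) = scaleC (c * d) x"
    and scaleC_one: "scaleC 1 x = x"
    and scaleR_scaleC: "scaleR r x = scaleC (complex_of_real r) x"
    and mult_scaleC_left: "scaleC c x * y = scaleC c (x * y)"
    and mult_scaleC_right: "x * scaleC c y = scaleC c (x * y)"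
    and norm_scaleC: "norm (scaleC c x) = cmod c * norm x"

text \<open>The class does not fix a unit, so being unital is a property. Neither \<open>norm e = 1\<close>
  nor \<open>e \<noteq> 0\<close> is demanded.\<close>

definition unital :: "'a::complex_banach_algebra itself \<Rightarrow> bool" where
  "unital _ \<longleftrightarrow> (\<exists>e::'a. \<forall>a. e * a = a \<and> a * e = a)"

text \<open>Product of a nonempty list in a semigroup; \<open>prod_list\<close> and \<open>power\<close> need a unit. The
  value on the empty list is unspecified.\<close>

fun sprod :: "'a::semigroup_mult list \<Rightarrow> 'a" where
  "sprod [a] = a"
| "sprod (a # b # as) = a * sprod (b # as)"

definition spow :: "'a::semigroup_mult \<Rightarrow> nat \<Rightarrow> 'a" where
  "spow a n = sprod (replicate n a)"

definition n_Jordan_homomorphism ::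
    "nat \<Rightarrow> ('a::complex_banach_algebra \<Rightarrow> 'b::complex_banach_algebra) \<Rightarrow> bool" where
  "n_Jordan_homomorphism n \<phi> \<longleftrightarrow>
     Vector_Spaces.linear scaleC scaleC \<phi> \<and> (\<forall>a. \<phi> (spow a n) = spow (\<phi> a) n)"

definition n_homomorphism ::
    "nat \<Rightarrow> ('a::complex_banach_algebra \<Rightarrow> 'b::complex_banach_algebra) \<Rightarrow> bool" where
  "n_homomorphism n \<phi> \<longleftrightarrow>
     Vector_Spaces.linear scaleC scaleC \<phi> \<and>
     (\<forall>as. length as = n \<longrightarrow> \<phi> (sprod as) = sprod (map \<phi> as))"

definition map_commutative ::
    "('a::complex_banach_algebra \<Rightarrow> 'b::complex_banach_algebra) \<Rightarrow> bool" where
  "map_commutative \<phi> \<longleftrightarrow> (\<forall>a b. \<phi> a * \<phi> b = \<phi> b * \<phi> a)"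

end

theory Submission imports Defs begin

text \<open>Let \<open>e\<close> be the unit of the domain and \<open>u = \<phi> e\<close>. The identity
  \<open>\<phi> ((a + t e)\<^sup>n) = (\<phi> a + t u)\<^sup>n\<close> holds for every real \<open>t\<close>. As \<open>a\<close> commutes with \<open>e\<close>, and
  \<open>\<phi> a\<close> with \<open>u\<close>, both sides expand by the binomial theorem, and comparing the coefficients of
  \<open>t ^ (n - 1)\<close> and \<open>t ^ (n - 2)\<close> gives \<open>\<phi> a = \<phi> a u\<^bsup>n-1\<^esup>\<close> and
  \<open>\<phi> (a\<^sup>2) = (\<phi> a)\<^sup>2 u\<^bsup>n-2\<^esup>\<close> (lemma \<open>Jordan_mixed_powers\<close>). So \<open>u\<^bsup>n-1\<^esup>\<close> is an identity on the
  range of \<open>\<phi>\<close>, and the twisted map \<open>\<psi> a = \<phi> a u\<^bsup>n-2\<^esup>\<close>, from which \<open>\<phi> a = \<psi> a u\<close> is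
  recovered, preserves squares.

  A square-preserving additive map \<open>\<psi>\<close> with commuting values satisfies
  \<open>\<psi> (a b) + \<psi> (b a) = 2 \<psi> a \<psi> b\<close> and \<open>\<psi> (a b) \<psi> (b a) = (\<psi> a)\<^sup>2 (\<psi> b)\<^sup>2\<close>. The sum and the product
  of \<open>\<psi> (a b)\<close> and \<open>\<psi> (b a)\<close> are thus those of a double root, so the square of their difference,
  which is \<open>\<psi> ((a b - b a)\<^sup>2)\<close>, vanishes (lemma \<open>square_preserving_commutator_square\<close>). The
  hypothesis on \<open>\<phi> (x\<^sup>2)\<close> then kills \<open>\<psi> (a b - b a)\<close>, so \<open>\<psi>\<close> is multiplicative. Hence
  \<open>\<phi> (a b) = \<psi> a \<phi> b = \<phi> a u\<^bsup>n-2\<^esup> \<phi> b\<close>. Iterated over \<open>n\<close> factors, this leaves the product of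
  the \<open>\<phi> a\<^sub>i\<close> times \<open>u\<^bsup>(n-1)(n-2)\<^esup>\<close>, which the identity \<open>u\<^bsup>n-1\<^esup>\<close> absorbs.

  Since the codomain need not have a unit, every monomial below is the product of a nonempty list,
  so that a factor such as \<open>u\<^bsup>n-2\<^esup>\<close> causes no trouble when \<open>n = 2\<close>.\<close>

section \<open>Products of nonempty lists\<close>

lemma sprod_Cons: "xs \<noteq> [] \<Longrightarrow> sprod (x # xs) = x * sprod xs"
  by (cases xs) auto

lemma sprod_append: "xs \<noteq> [] \<Longrightarrow> ys \<noteq> [] \<Longrightarrow> sprod (xs @ ys) = sprod xs * sprod ys"
proof (induction xs)
  case (Cons x xs)
  then show ?case by (cases "xs = []") (simp_all add: sprod_Cons mult.assoc)
qed simp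

lemma sprod_move_front:
  assumes "\<And>y. y \<in> set ys \<Longrightarrow> x * y = y * x" "ys @ zs \<noteq> []"
  shows "sprod (ys @ x # zs) = x * sprod (ys @ zs)"
  using assms
proof (induction ys)
  case Nil
  then show ?case by (simp add: sprod_Cons)
next
  case (Cons y ys)
  have xy: "x * y = y * x" using Cons.prems by simp
  show ?case
  proof (cases "ys @ zs = []")
    case True
    then show ?thesis using xy by simp
  next
    case False
    then have "sprod ((y # ys) @ x # zs) = y * (x * sprod (ys @ zs))"
      using Cons by (simp add: sprod_Cons)
    also have "\<dots> = x * (y * sprod (ys @ zs))"
      using xy by (metis mult.assoc)
    finally show ?thesis using False by (simp add: sprod_Cons)
  qed
qed

lemma sprod_cong_mset:
  assumes "\<And>x y. x \<in> set xs \<Longrightarrow> y \<in> set xs \<Longrightarrow> x * y = y * x" "mset xs = mset ys"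
  shows "sprod xs = sprod ys"
  using assms
proof (induction xs arbitrary: ys)
  case Nil
  then show ?case by simp
next
  case (Cons x xs)
  have "x \<in> set ys"
    using Cons.prems(2) by (metis list.set_intros(1) set_mset_mset)
  then obtain l r where ys: "ys = l @ x # r" by (meson split_list)
  have m: "mset xs = mset (l @ r)" using Cons.prems(2) ys by simp
  then have s: "set xs = set (l @ r)" by (metis set_mset_mset)
  show ?case
  proof (cases "xs = []")
    case True
    then show ?thesis using s ys by simp
  next
    case False
    then have "l @ r \<noteq> []" using s by auto
    moreover have "\<And>y. y \<in> set l \<Longrightarrow> x * y = y * x" using Cons.prems(1) s by auto
    ultimately have "sprod ys = x * sprod (l @ r)"
      unfolding ys by (intro sprod_move_front)
    moreover have "sprod xs = sprod (l @ r)"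
      using Cons.prems(1) m by (intro Cons.IH) auto
    ultimately show ?thesis using False by (simp add: sprod_Cons)
  qed
qed

text \<open>Used both for the unit of the domain and for the power of its image that acts as an
  identity on the range.\<close>

lemma sprod_absorb:
  assumes "xs \<noteq> []" "us \<noteq> []" "last xs * sprod us = last xs"
  shows "sprod (xs @ us) = sprod xs"
  using assms(1,3)
proof (induction xs)
  case (Cons x xs)
  then show ?case
    using assms(2) by (cases "xs = []") (simp_all add: sprod_Cons)
qed simp

lemma sprod_absorb_replicate:
  assumes "xs \<noteq> []" "m > 0" "last xs * sprod (replicate m u) = last xs"
  shows "sprod (xs @ replicate (m * j) u) = sprod xs"
proof (induction j)
  case (Suc j)
  have ne: "replicate m u \<noteq> []" using assms(2) by simp
  have "sprod (xs @ replicate (m * Suc j) u)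
      = sprod ((xs @ replicate m u) @ replicate (m * j) u)"
    by (simp add: replicate_add)
  also have "\<dots> = sprod (xs @ replicate (m * j) u)"
  proof (cases "m * j = 0")
    case True
    show ?thesis using sprod_absorb[OF assms(1) ne assms(3)] unfolding True by simp
  next
    case False
    show ?thesis
      using False assms(1) ne sprod_absorb[OF assms(1) ne assms(3)]
      by (simp add: sprod_append mult.assoc[symmetric])
  qed
  finally show ?case using Suc.IH by simp
qed simp

section \<open>Comparison of coefficients\<close>

text \<open>Passing from \<open>p t\<close> to \<open>p (2 t) - 2\<^sup>n p t\<close> removes the top coefficient and multiplies each
  lower one by a nonzero number, so the degree can be lowered without division or limits.\<close>

lemma vector_polynomial_coeffs_zero:
  fixes c :: "nat \<Rightarrow> 'a::real_vector"
  assumes "\<And>t::real. (\<Sum>k\<le>n. t ^ k *\<^sub>R c k) = 0" "k \<le> n"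
  shows "c k = 0"
  using assms
proof (induction n arbitrary: c k)
  case 0
  then show ?case using "0.prems"(1)[of 1] by simp
next
  case (Suc n)
  have "(\<Sum>k\<le>n. t ^ k *\<^sub>R ((2 ^ k - 2 ^ Suc n) *\<^sub>R c k)) = 0" for t :: real
  proof -
    have "0 = (\<Sum>k\<le>Suc n. (2 * t) ^ k *\<^sub>R c k) - 2 ^ Suc n *\<^sub>R (\<Sum>k\<le>Suc n. t ^ k *\<^sub>R c k)"
      by (simp only: Suc.prems(1)) simp
    also have "\<dots> = (\<Sum>k\<le>Suc n. t ^ k *\<^sub>R ((2 ^ k - 2 ^ Suc n) *\<^sub>R c k))"
      unfolding scaleR_sum_right sum_subtractf[symmetric]
      by (intro sum.cong refl) (simp add: power_mult_distrib algebra_simps)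
    finally show ?thesis by simp
  qed
  then have lower: "c k = 0" if "k \<le> n" for k
  proof -
    have "(2 ^ k - 2 ^ Suc n) *\<^sub>R c k = 0"
      using Suc.IH[of "\<lambda>k. (2 ^ k - 2 ^ Suc n) *\<^sub>R c k" k]
        \<open>\<And>t. (\<Sum>k\<le>n. t ^ k *\<^sub>R ((2 ^ k - 2 ^ Suc n) *\<^sub>R c k)) = 0\<close> that by blast
    moreover have "(2::real) ^ k < 2 ^ Suc n" using that by (intro power_strict_increasing) auto
    ultimately show ?thesis by simp
  qed
  show ?case
  proof (cases "k \<le> n")
    case False
    then have "k = Suc n" using Suc.prems(2) by simp
    then show ?thesis using Suc.prems(1)[of 1] lower by simp
  qed (rule lower)
qed

text \<open>Writing the monomial of degree \<open>n - k\<close> in \<open>x\<close> and \<open>k\<close> in \<open>y\<close> as a single list keeps the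
  terms \<open>k = 0\<close> and \<open>k = n\<close> meaningful without a unit, which a product of two powers would not.\<close>

lemma spow_binomial:
  fixes x y :: "'a::real_algebra"
  assumes xy: "x * y = y * x" and "n \<ge> 1"
  shows "spow (x + t *\<^sub>R y) n
    = (\<Sum>k\<le>n. (t ^ k * real (n choose k)) *\<^sub>R sprod (replicate (n - k) x @ replicate k y))"
  using assms(2)
proof (induction n rule: nat_induct_at_least)
  case base
  show ?case by (simp add: spow_def)
next
  case (Suc n)
  define W where "W = (\<lambda>n k. sprod (replicate (n - k) x @ replicate k y))"
  have ne: "replicate (n - k) x @ replicate k y \<noteq> []" if "k \<le> n" for k
    using that Suc.hyps by auto
  have Wx: "x * W n k = W (Suc n) k" if "k \<le> n" for k
    unfolding W_def using that ne[OF that] by (simp add: Suc_diff_le sprod_Cons)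
  have Wy: "y * W n k = W (Suc n) (Suc k)" if "k \<le> n" for k
  proof -
    have "y * W n k = sprod (y # replicate (n - k) x @ replicate k y)"
      unfolding W_def using ne[OF that] by (simp add: sprod_Cons)
    also have "\<dots> = W (Suc n) (Suc k)"
      unfolding W_def using xy by (intro sprod_cong_mset) auto
    finally show ?thesis .
  qed
  let ?b = "\<lambda>n k. t ^ k * real (n choose k)"
  have "spow (x + t *\<^sub>R y) (Suc n) = (x + t *\<^sub>R y) * spow (x + t *\<^sub>R y) n"
    using Suc.hyps unfolding spow_def by (simp add: sprod_Cons)
  also have "\<dots> = (\<Sum>k\<le>n. ?b n k *\<^sub>R (x * W n k)) + (\<Sum>k\<le>n. (t * ?b n k) *\<^sub>R (y * W n k))"
    using Suc.IH unfolding W_def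
    by (simp add: distrib_right sum_distrib_left mult_ac scaleR_add_right sum.distrib)
  also have "\<dots> = (\<Sum>k\<le>n. ?b n k *\<^sub>R W (Suc n) k)
      + (\<Sum>k\<le>n. (t ^ Suc k * real (n choose k)) *\<^sub>R W (Suc n) (Suc k))"
    using Wx Wy by (simp add: mult.assoc)
  also have "(\<Sum>k\<le>n. ?b n k *\<^sub>R W (Suc n) k) = (\<Sum>k\<le>Suc n. ?b n k *\<^sub>R W (Suc n) k)"
    by (simp add: binomial_eq_0)
  also have "\<dots> = W (Suc n) 0 + (\<Sum>k\<le>n. ?b n (Suc k) *\<^sub>R W (Suc n) (Suc k))"
    by (simp only: sum.atMost_Suc_shift) simp
  also have "\<dots> + (\<Sum>k\<le>n. (t ^ Suc k * real (n choose k)) *\<^sub>R W (Suc n) (Suc k))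
      = W (Suc n) 0 + (\<Sum>k\<le>n. ?b (Suc n) (Suc k) *\<^sub>R W (Suc n) (Suc k))"
    by (simp add: sum.distrib scaleR_add_left distrib_left add_ac)
  also have "\<dots> = (\<Sum>k\<le>Suc n. ?b (Suc n) k *\<^sub>R W (Suc n) k)"
    by (simp only: sum.atMost_Suc_shift) simp
  finally show ?case unfolding W_def .
qed

text \<open>Partial polarization of the Jordan identity along the line \<open>a + t b\<close>. With \<open>b\<close> the unit, it
  relates all lower powers of \<open>a\<close> to those of \<open>\<phi> a\<close>.\<close>

lemma Jordan_mixed_powers:
  fixes \<phi> :: "'a::real_algebra \<Rightarrow> 'b::real_algebra"
  assumes "linear \<phi>" and Jordan: "\<And>a. \<phi> (spow a n) = spow (\<phi> a) n" and "n \<ge> 1"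
    and ab: "a * b = b * a" "\<phi> a * \<phi> b = \<phi> b * \<phi> a" and "k \<le> n"
  shows "\<phi> (sprod (replicate (n - k) a @ replicate k b))
    = sprod (replicate (n - k) (\<phi> a) @ replicate k (\<phi> b))"
proof -
  interpret linear \<phi> by fact
  define c where "c = (\<lambda>k. real (n choose k) *\<^sub>R
      (\<phi> (sprod (replicate (n - k) a @ replicate k b))
        - sprod (replicate (n - k) (\<phi> a) @ replicate k (\<phi> b))))"
  have "(\<Sum>k\<le>n. t ^ k *\<^sub>R c k) = 0" for t
  proof -
    have "\<phi> (spow (a + t *\<^sub>R b) n) = spow (\<phi> a + t *\<^sub>R \<phi> b) n"
      unfolding Jordan by (simp add: add scale)
    then show ?thesis
      unfolding spow_binomial[OF ab(1) \<open>n \<ge> 1\<close>] spow_binomial[OF ab(2) \<open>n \<ge> 1\<close>] c_def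
      by (simp add: sum scale scaleR_diff_right sum_subtractf)
  qed
  then have "c k = 0" using vector_polynomial_coeffs_zero \<open>k \<le> n\<close> by blast
  then show ?thesis using \<open>k \<le> n\<close> unfolding c_def by simp
qed

section \<open>Square-preserving maps with commuting values\<close>

lemma double_cancel: "x = y" if "x + x = y + y" for x y :: "'a::real_vector"
  using that by (simp flip: scaleR_2)

lemma square_preserving_anticommutator:
  fixes \<psi> :: "'a::ring \<Rightarrow> 'b::ring"
  assumes "Modules.additive \<psi>" and sq: "\<And>x. \<psi> (x * x) = \<psi> x * \<psi> x"
    and comm: "\<And>x y. \<psi> x * \<psi> y = \<psi> y * \<psi> x"
  shows "\<psi> (a * b) + \<psi> (b * a) = \<psi> a * \<psi> b + \<psi> a * \<psi> b"
proof -
  interpret Modules.additive \<psi> by fact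
  have "\<psi> (a * a) + (\<psi> (a * b) + \<psi> (b * a)) + \<psi> (b * b) = \<psi> ((a + b) * (a + b))"
    by (simp add: distrib_left distrib_right add add_ac)
  also have "\<dots> = (\<psi> a + \<psi> b) * (\<psi> a + \<psi> b)"
    by (simp only: sq add)
  also have "\<dots> = \<psi> (a * a) + (\<psi> a * \<psi> b + \<psi> a * \<psi> b) + \<psi> (b * b)"
    by (simp add: distrib_left distrib_right sq comm[of b a] add_ac)
  finally show ?thesis by simp
qed

text \<open>The reason is the identity
  \<open>2 a b a = (a (a b + b a) + (a b + b a) a) - (a\<^sup>2 b + b a\<^sup>2)\<close>, in which both brackets are
  anticommutators.\<close>

lemma square_preserving_triple:
  fixes \<psi> :: "'a::ring \<Rightarrow> 'b::real_algebra"
  assumes "Modules.additive \<psi>" and sq: "\<And>x. \<psi> (x * x) = \<psi> x * \<psi> x"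
    and comm: "\<And>x y. \<psi> x * \<psi> y = \<psi> y * \<psi> x"
  shows "\<psi> (a * b * a) = \<psi> a * \<psi> a * \<psi> b"
proof -
  interpret Modules.additive \<psi> by fact
  note anti = square_preserving_anticommutator[of \<psi>, OF assms]
  let ?c = "a * b + b * a" and ?p = "\<psi> a * \<psi> a * \<psi> b"
  have c: "\<psi> ?c = \<psi> a * \<psi> b + \<psi> a * \<psi> b" by (simp add: add anti)
  have "a * b * a + a * b * a = a * ?c + ?c * a - (a * a * b + b * (a * a))"
    by (simp add: algebra_simps)
  then have "\<psi> (a * b * a + a * b * a) = \<psi> (a * ?c + ?c * a - (a * a * b + b * (a * a)))"
    by (rule arg_cong)
  then have "\<psi> (a * b * a) + \<psi> (a * b * a)
      = (\<psi> (a * ?c) + \<psi> (?c * a)) - (\<psi> (a * a * b) + \<psi> (b * (a * a)))"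
    by (simp only: add diff)
  also have "\<dots> = (\<psi> a * \<psi> ?c + \<psi> a * \<psi> ?c) - (\<psi> (a * a) * \<psi> b + \<psi> (a * a) * \<psi> b)"
    by (simp only: anti)
  also have "\<dots> = ?p + ?p"
    unfolding c sq by (simp add: algebra_simps)
  finally show ?thesis by (rule double_cancel)
qed

text \<open>Let \<open>p\<close> and \<open>q\<close> be the values of \<open>\<psi>\<close> at \<open>a b\<close> and \<open>b a\<close>. Their sum comes from the
  anticommutator of \<open>a\<close> and \<open>b\<close>, and their product from the anticommutator of \<open>a b\<close> and \<open>b a\<close>,
  because \<open>(a b) (b a) = a b\<^sup>2 a\<close> is a triple product. They satisfy \<open>(p + q)\<^sup>2 = 4 p q\<close>.\<close>

lemma square_preserving_commutator_square:
  fixes \<psi> :: "'a::ring \<Rightarrow> 'b::real_algebra"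
  assumes "Modules.additive \<psi>" and sq: "\<And>x. \<psi> (x * x) = \<psi> x * \<psi> x"
    and comm: "\<And>x y. \<psi> x * \<psi> y = \<psi> y * \<psi> x"
  shows "\<psi> ((a * b - b * a) * (a * b - b * a)) = 0"
proof -
  interpret Modules.additive \<psi> by fact
  note anti = square_preserving_anticommutator[of \<psi>, OF assms]
  note triple = square_preserving_triple[of \<psi>, OF assms]
  let ?p = "\<psi> (a * b)" and ?q = "\<psi> (b * a)" and ?s = "\<psi> a * \<psi> a * (\<psi> b * \<psi> b)"
  have left_comm: "\<psi> x * (\<psi> y * z) = \<psi> y * (\<psi> x * z)" for x y z
    using comm[of x y] by (simp add: mult.assoc[symmetric])
  have s': "\<psi> b * \<psi> b * (\<psi> a * \<psi> a) = ?s"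
    by (simp add: mult.assoc comm left_comm)
  have "?p * ?q + ?p * ?q = \<psi> ((a * b) * (b * a)) + \<psi> ((b * a) * (a * b))"
    by (simp only: anti)
  also have "\<dots> = \<psi> (a * (b * b) * a) + \<psi> (b * (a * a) * b)"
    by (simp add: mult.assoc)
  also have "\<dots> = ?s + ?s"
    unfolding triple sq s' ..
  finally have pq: "?p * ?q = ?s" by (rule double_cancel)
  have "(?p + ?q) * (?p + ?q) = (?s + ?s) + (?s + ?s)"
  proof -
    have "(\<psi> a * \<psi> b) * (\<psi> a * \<psi> b) = ?s" by (simp add: mult.assoc comm left_comm)
    then show ?thesis unfolding anti by (simp add: distrib_left distrib_right)
  qed
  then have "(?p - ?q) * (?p - ?q) = 0"
    using pq comm[of "a * b" "b * a"] by (simp add: algebra_simps)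
  then show ?thesis by (simp add: sq diff)
qed

section \<open>Jordan homomorphisms that are homomorphisms\<close>

lemma complex_linear_imp_linear:
  fixes \<phi> :: "'a::complex_banach_algebra \<Rightarrow> 'b::complex_banach_algebra"
  assumes "Vector_Spaces.linear scaleC scaleC \<phi>"
  shows "linear \<phi>"
proof -
  interpret Vector_Spaces.linear "scaleC :: complex \<Rightarrow> 'a \<Rightarrow> 'a" "scaleC :: complex \<Rightarrow> 'b \<Rightarrow> 'b" \<phi>
    by fact
  show ?thesis by (intro linearI) (simp_all add: add scale scaleR_scaleC)
qed

theorem theorem2p6:
  fixes n :: nat
    and \<phi> :: "'a::complex_banach_algebra \<Rightarrow> 'b::complex_banach_algebra"
  assumes "n \<ge> 2"
    and "unital TYPE('a)"
    and "n_Jordan_homomorphism n \<phi>"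
    and "map_commutative \<phi>"
    and "\<And>x. \<phi> (spow x 2) = 0 \<Longrightarrow> \<phi> x = 0"
  shows "n_homomorphism n \<phi>"
proof -
  have clin: "Vector_Spaces.linear scaleC scaleC \<phi>"
    and Jordan: "\<And>a. \<phi> (spow a n) = spow (\<phi> a) n"
    using assms(3) unfolding n_Jordan_homomorphism_def by auto
  have lin: "linear \<phi>" using clin by (rule complex_linear_imp_linear)
  interpret linear \<phi> by (rule lin)
  have comm: "\<phi> a * \<phi> b = \<phi> b * \<phi> a" for a b
    using assms(4) unfolding map_commutative_def by blast
  have reduced: "\<phi> x = 0" if "\<phi> (x * x) = 0" for x
    using assms(5)[of x] that by (simp add: spow_def numeral_2_eq_2)
  obtain e :: 'a where e: "\<And>a. e * a = a" "\<And>a. a * e = a"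
    using assms(2) unfolding unital_def by auto
  define u where "u = \<phi> e"
  define U where "U = replicate (n - 2) u"
  have setU: "set U \<subseteq> range \<phi>" unfolding U_def u_def by auto
  have reorder: "sprod xs = sprod ys" if "set xs \<subseteq> range \<phi>" "mset xs = mset ys" for xs ys
  proof (rule sprod_cong_mset)
    fix x y assume "x \<in> set xs" "y \<in> set xs"
    then show "x * y = y * x" using that(1) comm by blast
  qed (fact that(2))

  have sprod_e: "sprod (xs @ replicate k e) = sprod xs" if "xs \<noteq> []" for xs k
    using sprod_absorb_replicate[of xs 1 e k] that e by simp
  have lower_power:
    "\<phi> (sprod (replicate (n - k) a)) = sprod (replicate (n - k) (\<phi> a) @ replicate k u)"
    if "k < n" for a k
    using Jordan_mixed_powers[OF lin Jordan, of a e k] that e comm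
      sprod_e[of "replicate (n - k) a" k]
    unfolding u_def by simp
  have nU: "replicate (n - 1) u = u # U"
    using assms(1) unfolding U_def by (simp add: replicate_Suc[symmetric] Suc_diff_le
        numeral_2_eq_2 Suc_diff_Suc del: replicate_Suc)
  have id: "\<phi> a = sprod (\<phi> a # u # U)" for a
    using lower_power[of "n - 1" a] assms(1) nU by simp
  have square: "\<phi> (a * a) = sprod (\<phi> a # \<phi> a # U)" for a
    using lower_power[of "n - 2" a] assms(1) unfolding U_def by (simp add: numeral_2_eq_2)

  define \<psi> where "\<psi> = (\<lambda>a. sprod (\<phi> a # U))"
  have \<psi>_eq: "\<psi> a = (if U = [] then \<phi> a else \<phi> a * sprod U)" for a
    unfolding \<psi>_def by (simp add: sprod_Cons)
  have \<psi>_add: "Modules.additive \<psi>"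
    by unfold_locales (simp add: \<psi>_eq add distrib_right)
  have \<psi>_comm: "\<psi> a * \<psi> b = \<psi> b * \<psi> a" for a b
  proof -
    have "sprod ((\<phi> a # U) @ (\<phi> b # U)) = sprod ((\<phi> b # U) @ (\<phi> a # U))"
      using setU by (intro reorder) auto
    then show ?thesis unfolding \<psi>_def by (subst (asm) (1 2) sprod_append) auto
  qed
  have \<psi>_u: "\<psi> a * u = \<phi> a" for a
  proof -
    have "\<psi> a * u = sprod ((\<phi> a # U) @ [u])"
      unfolding \<psi>_def by (subst sprod_append) auto
    also have "\<dots> = sprod (\<phi> a # u # U)"
      using setU by (intro reorder) (auto simp: u_def)
    finally show ?thesis using id[of a] by simp
  qed
  have \<psi>_sq: "\<psi> (a * a) = \<psi> a * \<psi> a" for a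
  proof -
    have "\<psi> (a * a) = sprod ((\<phi> a # \<phi> a # U) @ U)"
      unfolding \<psi>_eq square by (cases "U = []") (simp_all add: sprod_append del: append_Cons)
    also have "\<dots> = sprod ((\<phi> a # U) @ (\<phi> a # U))"
      using setU by (intro reorder) auto
    also have "\<dots> = \<psi> a * \<psi> a"
      unfolding \<psi>_def by (subst sprod_append) auto
    finally show ?thesis .
  qed
  have \<psi>_mult: "\<psi> (a * b) = \<psi> a * \<psi> b" for a b
  proof -
    interpret \<psi>: Modules.additive \<psi> by (rule \<psi>_add)
    let ?c = "a * b - b * a"
    have "\<psi> (?c * ?c) = 0"
      by (rule square_preserving_commutator_square[of \<psi>, OF \<psi>_add \<psi>_sq \<psi>_comm])
    then have "\<phi> (?c * ?c) = 0" using \<psi>_u[of "?c * ?c"] by simp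
    then have "\<psi> ?c = 0" using reduced[of ?c] by (simp add: \<psi>_eq)
    then have "\<psi> (a * b) = \<psi> (b * a)" by (simp add: \<psi>.diff)
    then have "\<psi> (a * b) + \<psi> (a * b) = \<psi> a * \<psi> b + \<psi> a * \<psi> b"
      using square_preserving_anticommutator[of \<psi>, OF \<psi>_add \<psi>_sq \<psi>_comm, of a b]
      by simp
    then show ?thesis by (rule double_cancel)
  qed
  have \<phi>_mult: "\<phi> (a * b) = \<psi> a * \<phi> b" for a b
    by (metis \<psi>_mult \<psi>_u mult.assoc)

  have \<phi>_sprod: "\<phi> (sprod as) = sprod (map \<phi> as @ replicate ((n - 2) * (length as - 1)) u)"
    if "as \<noteq> []" for as
    using that
  proof (induction as rule: list_nonempty_induct)
    case (single a)
    then show ?case by simp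
  next
    case (cons a as)
    let ?r = "replicate ((n - 2) * (length as - 1)) u"
    have "\<phi> (sprod (a # as)) = \<psi> a * \<phi> (sprod as)"
      using cons.hyps by (simp add: sprod_Cons \<phi>_mult)
    also have "\<dots> = sprod ((\<phi> a # U) @ (map \<phi> as @ ?r))"
      unfolding cons.IH \<psi>_def using cons.hyps by (subst sprod_append) auto
    also have "\<dots> = sprod (map \<phi> (a # as) @ (U @ ?r))"
      using setU by (intro reorder) (auto simp: u_def)
    also have "U @ ?r = replicate ((n - 2) * (length (a # as) - 1)) u"
      unfolding U_def replicate_add[symmetric]
      using cons.hyps by (cases as) simp_all
    finally show ?case .
  qed

  have "\<phi> (sprod as) = sprod (map \<phi> as)" if len: "length as = n" for as
  proof -
    have ne: "as \<noteq> []" using len assms(1) by auto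
    then have "last (map \<phi> as) * sprod (replicate (n - 1) u) = last (map \<phi> as)"
      using id[of "last as"] by (simp add: nU last_map sprod_Cons del: One_nat_def)
    then have "sprod (map \<phi> as @ replicate ((n - 1) * (n - 2)) u) = sprod (map \<phi> as)"
      using ne assms(1) by (intro sprod_absorb_replicate) auto
    then show ?thesis using \<phi>_sprod[OF ne] len by (simp add: mult.commute)
  qed
  then show ?thesis using clin unfolding n_homomorphism_def by blast
qed

end
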